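(* Let $N\geq 2n-1$, and let $\mathcal{P}^N$ be the $N$-dimensional space of all real polynomials of the form $\alpha_1x^N+\alpha_2x^{N-1}+\cdots+\alpha_Nx$. Then for an arbitrary independent $n$-chord diagram $\{(a_1,b_1),\dots,(a_n,b_n)\}$, the codimension in $\mathcal{P}^N$ of the subspace defined by the $n$ conditions $f(a_i)=f(b_i)$, $i=1,\dots,n$, is equal to $n$.
   Context: A chord is an unordered pair $(a,b)$ of distinct points of $\mathbb{R}^1$; an $n$-chord diagram is an unordered collection of $n$ pairwise distinct chords $\{(a_1,b_1),\dots,(a_n,b_n)\}$. It is independent if the subalgebra of the space $C^0(\mathbb{R}^1,\mathbb{R}^1)$ of continuous functions consisting of all functions satisfying $f(a_i)=f(b_i)$, $i=1,\dots,n$, has codimension exactly $n$. *)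

theory Defs
  imports "HOL-Analysis.Analysis" "HOL-Library.Function_Algebras"
begin

(* The codimension of the subspace W in the space V is n: the quotient space V / W has a basis
   consisting of the n cosets of the elements of B.  The first condition on B says that these
   cosets are linearly independent (in particular pairwise distinct), the second that they
   span V / W. *)
definition (in vector_space) has_codim :: "'b set \<Rightarrow> 'b set \<Rightarrow> nat \<Rightarrow> bool" where
  "has_codim V W n \<longleftrightarrow> subspace V \<and> subspace W \<and> W \<subseteq> V \<and>
     (\<exists>B. finite B \<and> card B = n \<and> B \<subseteq> V \<and>
        (\<forall>c. (\<Sum>b\<in>B. scale (c b) b) \<in> W \<longrightarrow> (\<forall>b\<in>B. c b = 0)) \<and>
        (\<forall>v\<in>V. \<exists>c. v - (\<Sum>b\<in>B. scale (c b) b) \<in> W))"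

definition fun_scale :: "real \<Rightarrow> (real \<Rightarrow> real) \<Rightarrow> real \<Rightarrow> real" where
  "fun_scale c f = (\<lambda>x. c * f x)"

interpretation real_fun: vector_space fun_scale
  by unfold_locales (auto simp: fun_scale_def fun_eq_iff algebra_simps)

definition chord :: "real set \<Rightarrow> bool" where
  "chord c \<longleftrightarrow> (\<exists>a b. a \<noteq> b \<and> c = {a, b})"

definition chord_diagram :: "nat \<Rightarrow> real set set \<Rightarrow> bool" where
  "chord_diagram n D \<longleftrightarrow> finite D \<and> card D = n \<and> (\<forall>c\<in>D. chord c)"

definition respecting :: "(real \<Rightarrow> real) set \<Rightarrow> real set set \<Rightarrow> (real \<Rightarrow> real) set" where
  "respecting V D = {f \<in> V. \<forall>a b. {a, b} \<in> D \<longrightarrow> f a = f b}"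

definition C0 :: "(real \<Rightarrow> real) set" where
  "C0 = {f. continuous_on UNIV f}"

definition independent_chord_diagram :: "nat \<Rightarrow> real set set \<Rightarrow> bool" where
  "independent_chord_diagram n D \<longleftrightarrow>
     chord_diagram n D \<and> real_fun.has_codim C0 (respecting C0 D) n"

(* Real polynomials are identified with the functions they define on the real line. *)
definition poly_space :: "nat \<Rightarrow> (real \<Rightarrow> real) set" where
  "poly_space N = {f. \<exists>\<alpha>. f = (\<lambda>x. \<Sum>k=1..N. \<alpha> k * x ^ (N + 1 - k))}"

end

theory Submission
  imports Defs
begin

text \<open>The endpoints of the chords form a set of at most \<open>2 n\<close> points, and \<open>2 n - 1 \<le> N\<close>. Hence every
  function agrees on the endpoints, up to an additive constant, with a member of \<open>\<P>\<^sup>N\<close>, and the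
  chord conditions only see differences of values at endpoints. So a basis of the quotient for
  continuous functions can be replaced, element by element, by interpolating polynomials.\<close>

section \<open>Polynomial interpolation, exact and up to constants\<close>

lemma polynomial_interpolation:
  fixes f :: "'a::field \<Rightarrow> 'a"
  assumes "finite S"
  shows "\<exists>p. degree p \<le> card S - 1 \<and> (\<forall>x\<in>S. poly p x = f x)"
  using assms
proof (induction S rule: finite_induct)
  case empty
  \<comment> \<open>For natural numbers \<open>card {} - 1\<close> is 0, so the zero polynomial
    meets the degree bound.\<close>
  show ?case by (intro exI[of _ 0]) simp
next
  case (insert a S)
  then obtain p where p: "degree p \<le> card S - 1" "\<forall>x\<in>S. poly p x = f x"
    by blast
  \<comment> \<open>Newton's form: \<open>q\<close> vanishes on \<open>S\<close> but not at
    \<open>a\<close>, so adding a multiple of it keeps the old values and can correct the one at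
    \<open>a\<close>. Its degree is at most \<open>card S\<close>, the new bound.\<close>
  define q where "q = (\<Prod>x\<in>S. [:- x, 1:])"
  define r where "r = p + smult ((f a - poly p a) / poly q a) q"
  have "degree q \<le> card S"
    using degree_prod_sum_le[OF insert.hyps(1), of "\<lambda>x. [:- x, 1:]"] by (simp add: q_def)
  then have "degree r \<le> card S"
    unfolding r_def using p(1) by (intro degree_add_le order.trans[OF degree_smult_le]) auto
  moreover have "poly q a \<noteq> 0"
    using insert.hyps by (auto simp: q_def poly_prod)
  then have "poly r a = f a"
    by (simp add: r_def)
  moreover have "poly q x = 0" if "x \<in> S" for x
    using that insert.hyps(1) by (auto simp: q_def poly_prod)
  then have "\<forall>x\<in>S. poly r x = f x"
    using p(2) by (simp add: r_def)
  ultimately show ?case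
    using insert.hyps by (intro exI[of _ r]) simp
qed

lemma poly_minus_const_in_poly_space:
  assumes "degree p \<le> N"
  shows "(\<lambda>x. poly p x - poly p 0) \<in> poly_space N"
proof -
  have "poly p x - poly p 0 = (\<Sum>k=1..N. coeff p (N + 1 - k) * x ^ (N + 1 - k))" for x
  proof -
    have "poly p x = (\<Sum>i\<le>N. coeff p i * x ^ i)"
      unfolding poly_altdef using assms
      by (intro sum.mono_neutral_left) (auto simp: coeff_eq_0)
    also have "\<dots> = coeff p 0 + (\<Sum>i=1..N. coeff p i * x ^ i)"
      by (simp add: sum.atMost_shift sum.atLeast1_atMost_eq)
    \<comment> \<open>Reversing the index matches \<open>poly_space\<close>, where exponents descend
      from \<open>N\<close> to 1.\<close>
    also have "(\<Sum>i=1..N. coeff p i * x ^ i) = (\<Sum>k=1..N. coeff p (N + 1 - k) * x ^ (N + 1 - k))"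
      by (subst sum.atLeastAtMost_rev) (simp add: add.commute)
    finally show ?thesis
      by (simp add: poly_0_coeff_0)
  qed
  then show ?thesis
    unfolding poly_space_def by (intro CollectI exI[of _ "\<lambda>k. coeff p (N + 1 - k)"] ext)
qed

text \<open>Degree \<open>N\<close> suffices to interpolate at \<open>N + 1\<close> points. Members
  of \<open>poly_space N\<close> have no constant term; dropping it changes values but not their
  differences.\<close>

lemma poly_space_interpolates_differences:
  assumes "finite S" "card S \<le> N + 1"
  shows "\<exists>g\<in>poly_space N. \<forall>x\<in>S. \<forall>y\<in>S. g x - g y = f x - f y"
proof -
  obtain p where p: "degree p \<le> card S - 1" "\<forall>x\<in>S. poly p x = f x"
    using polynomial_interpolation[OF assms(1)] by blast
  have "(\<lambda>x. poly p x - poly p 0) \<in> poly_space N"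
    using p(1) assms(2) by (intro poly_minus_const_in_poly_space) simp
  then show ?thesis
    using p(2) by (intro bexI[of _ "\<lambda>x. poly p x - poly p 0"]) simp_all
qed

section \<open>Function subspaces and the chord conditions\<close>

lemma subspace_poly_space: "real_fun.subspace (poly_space N)"
proof (rule real_fun.subspaceI)
  show "0 \<in> poly_space N"
    unfolding poly_space_def by (intro CollectI exI[of _ "\<lambda>_. 0"]) (simp add: fun_eq_iff)
next
  fix f g assume "f \<in> poly_space N" "g \<in> poly_space N"
  then obtain \<alpha> \<beta> where "f = (\<lambda>x. \<Sum>k=1..N. \<alpha> k * x ^ (N + 1 - k))"
      "g = (\<lambda>x. \<Sum>k=1..N. \<beta> k * x ^ (N + 1 - k))"
    unfolding poly_space_def by blast
  then show "f + g \<in> poly_space N"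
    unfolding poly_space_def
    by (intro CollectI exI[of _ "\<lambda>k. \<alpha> k + \<beta> k"])
      (simp add: fun_eq_iff distrib_right sum.distrib)
next
  fix c f assume "f \<in> poly_space N"
  then obtain \<alpha> where "f = (\<lambda>x. \<Sum>k=1..N. \<alpha> k * x ^ (N + 1 - k))"
    unfolding poly_space_def by blast
  then show "fun_scale c f \<in> poly_space N"
    unfolding poly_space_def
    by (intro CollectI exI[of _ "\<lambda>k. c * \<alpha> k"])
      (simp add: fun_eq_iff fun_scale_def sum_distrib_left mult.assoc)
qed

lemma subspace_C0: "real_fun.subspace C0"
  unfolding C0_def
  by (rule real_fun.subspaceI)
    (auto simp: fun_scale_def plus_fun_def zero_fun_def intro!: continuous_intros)

lemma poly_space_subset_C0: "poly_space N \<subseteq> C0"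
  by (auto simp: poly_space_def C0_def intro!: continuous_intros)

lemma subspace_respecting:
  assumes "real_fun.subspace V"
  shows "real_fun.subspace (respecting V D)"
proof (rule real_fun.subspaceI)
  show "0 \<in> respecting V D"
    using real_fun.subspace_0[OF assms] by (simp add: respecting_def)
next
  fix f g assume "f \<in> respecting V D" "g \<in> respecting V D"
  then show "f + g \<in> respecting V D"
    using real_fun.subspace_add[OF assms, of f g] by (auto simp: respecting_def)
next
  fix c f assume "f \<in> respecting V D"
  then show "fun_scale c f \<in> respecting V D"
    using real_fun.subspace_scale[OF assms, of f c] by (auto simp: respecting_def fun_scale_def)
qed

text \<open>Chord conditions depend only on differences of values at endpoints. Allowing two ambient
  spaces lets membership pass between polynomials and continuous functions in either
  direction.\<close>

lemma respecting_transfer: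
  assumes "f \<in> respecting V D" "g \<in> V'"
    and "\<And>x y. x \<in> \<Union>D \<Longrightarrow> y \<in> \<Union>D \<Longrightarrow> g x - g y = f x - f y"
  shows "g \<in> respecting V' D"
proof -
  have "g a = g b" if "{a, b} \<in> D" for a b
  proof -
    have "a \<in> \<Union>D" "b \<in> \<Union>D"
      using that by auto
    then have "g a - g b = f a - f b"
      by (rule assms(3))
    then show ?thesis
      using assms(1) that by (simp add: respecting_def)
  qed
  then show ?thesis
    using assms(2) by (simp add: respecting_def)
qed

section \<open>Linear combinations and codimension from an indexed family\<close>

lemma sum_fun_scale_apply: "(\<Sum>i\<in>I. fun_scale (c i) (f i)) x = (\<Sum>i\<in>I. c i * f i x)"
  by (induction I rule: infinite_finite_induct) (simp_all add: fun_scale_def)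

lemma (in vector_space) inj_on_if_independent_mod:
  assumes "finite B" "subspace W"
    and ind: "\<And>c. (\<Sum>b\<in>B. scale (c b) (P b)) \<in> W \<Longrightarrow> \<forall>b\<in>B. c b = 0"
  shows "inj_on P B"
proof (rule inj_onI, rule ccontr)
  fix u v assume uv: "u \<in> B" "v \<in> B" "P u = P v" "u \<noteq> v"
  \<comment> \<open>A collision \<open>P u = P v\<close> makes the combination
    \<open>P u - P v\<close> equal to 0, which lies in \<open>W\<close> although its coefficients
    are nonzero.\<close>
  define c :: "'c \<Rightarrow> 'a" where "c b = (if b = u then 1 else if b = v then - 1 else 0)" for b
  have "(\<Sum>b\<in>B. scale (c b) (P b)) = (\<Sum>b\<in>{u, v}. scale (c b) (P b))"
    using assms(1) uv by (intro sum.mono_neutral_right) (auto simp: c_def)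
  also have "\<dots> = 0"
    using uv by (simp add: c_def)
  finally have "\<forall>b\<in>B. c b = 0"
    using ind subspace_0[OF assms(2)] by simp
  then show False
    using uv(1) by (auto simp: c_def)
qed

text \<open>\<open>has_codim\<close> asks for a set of representatives, whereas replacing basis
  elements gives a family \<open>P\<close>. Independence modulo \<open>W\<close> makes
  \<open>P\<close> injective, so its image still has \<open>n\<close> elements and sums can be
  reindexed.\<close>

lemma (in vector_space) has_codimI_indexed:
  assumes "subspace V" "subspace W" "W \<subseteq> V" "finite B" "card B = n" "P ` B \<subseteq> V"
    and ind: "\<And>c. (\<Sum>b\<in>B. scale (c b) (P b)) \<in> W \<Longrightarrow> \<forall>b\<in>B. c b = 0"
    and span: "\<And>v. v \<in> V \<Longrightarrow> \<exists>c. v - (\<Sum>b\<in>B. scale (c b) (P b)) \<in> W"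
  shows "has_codim V W n"
proof -
  have inj: "inj_on P B"
    using inj_on_if_independent_mod[OF assms(4,2) ind] .
  have reindex: "(\<Sum>w\<in>P ` B. scale (c w) w) = (\<Sum>b\<in>B. scale (c (P b)) (P b))" for c
    using inj by (simp add: sum.reindex)
  have "\<exists>c. v - (\<Sum>w\<in>P ` B. scale (c w) w) \<in> W" if v: "v \<in> V" for v
  proof -
    obtain c where c: "v - (\<Sum>b\<in>B. scale (c b) (P b)) \<in> W"
      using span[OF v] by blast
    have "(\<Sum>w\<in>P ` B. scale (c (the_inv_into B P w)) w) = (\<Sum>b\<in>B. scale (c b) (P b))"
      unfolding reindex by (intro sum.cong) (simp_all add: the_inv_into_f_f[OF inj])
    then show ?thesis
      using c by (intro exI[of _ "\<lambda>w. c (the_inv_into B P w)"]) simp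
  qed
  moreover have "\<forall>w\<in>P ` B. c w = 0" if "(\<Sum>w\<in>P ` B. scale (c w) w) \<in> W" for c
    using ind[of "\<lambda>b. c (P b)"] that by (simp add: reindex)
  ultimately show ?thesis
    unfolding has_codim_def using assms(1-6) inj
    by (intro conjI exI[of _ "P ` B"]) (simp_all add: card_image)
qed

section \<open>Endpoints of chords and replacement of the basis\<close>

lemma chord_diagram_endpoints:
  assumes "chord_diagram n D"
  shows "finite (\<Union>D)" "card (\<Union>D) \<le> 2 * n"
proof -
  have D: "finite D" "card D = n" and ch: "\<And>c. c \<in> D \<Longrightarrow> finite c \<and> card c = 2"
    using assms by (auto simp: chord_diagram_def chord_def)
  show "finite (\<Union>D)"
    using D(1) ch by blast
  \<comment> \<open>Distinct chords may share an endpoint, so this is only an inequality.\<close>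
  have "card (\<Union>D) \<le> (\<Sum>c\<in>D. card c)"
    by (rule card_Union_le_sum_card)
  then show "card (\<Union>D) \<le> 2 * n"
    using D(2) ch by simp
qed

theorem proposition2:
  fixes N n :: nat and D :: "real set set"
  assumes "N \<ge> 2 * n - 1"
    and "independent_chord_diagram n D"
  shows "real_fun.has_codim (poly_space N) (respecting (poly_space N) D) n"
proof -
  have diag: "chord_diagram n D" and codim: "real_fun.has_codim C0 (respecting C0 D) n"
    using assms(2) by (auto simp: independent_chord_diagram_def)
  obtain B where B: "finite B" "card B = n" "B \<subseteq> C0"
    and ind: "\<And>c. (\<Sum>b\<in>B. fun_scale (c b) b) \<in> respecting C0 D \<Longrightarrow> \<forall>b\<in>B. c b = 0"
    and span: "\<And>v. v \<in> C0 \<Longrightarrow> \<exists>c. v - (\<Sum>b\<in>B. fun_scale (c b) b) \<in> respecting C0 D"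
    using codim unfolding real_fun.has_codim_def by auto
  \<comment> \<open>Truncated subtraction is harmless: \<open>2 * n - 1 \<le> N\<close> gives
    \<open>2 * n \<le> N + 1\<close> also for \<open>n = 0\<close>.\<close>
  have "card (\<Union>D) \<le> N + 1"
    using chord_diagram_endpoints(2)[OF diag] assms(1) by simp
  then have "\<forall>f. \<exists>g\<in>poly_space N. \<forall>x\<in>\<Union>D. \<forall>y\<in>\<Union>D. g x - g y = f x - f y"
    using poly_space_interpolates_differences chord_diagram_endpoints(1)[OF diag] by blast
  \<comment> \<open>\<open>P\<close> is an arbitrary choice of interpolants and need not be linear,
    so differences of linear combinations are compared term by term in
    \<open>sum_diff\<close>.\<close>
  then obtain P where P: "\<And>f. P f \<in> poly_space N"
    and P_diff: "\<And>f x y. x \<in> \<Union>D \<Longrightarrow> y \<in> \<Union>D \<Longrightarrow> P f x - P f y = f x - f y"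
    by metis
  have sum_diff: "(\<Sum>b\<in>B. fun_scale (c b) (P b)) x - (\<Sum>b\<in>B. fun_scale (c b) (P b)) y =
      (\<Sum>b\<in>B. fun_scale (c b) b) x - (\<Sum>b\<in>B. fun_scale (c b) b) y"
    if "x \<in> \<Union>D" "y \<in> \<Union>D" for c x y
    unfolding sum_fun_scale_apply sum_subtractf[symmetric] right_diff_distrib[symmetric]
    using P_diff[OF that] by simp
  show ?thesis
  proof (rule real_fun.has_codimI_indexed[where B = B and P = P])
    show "real_fun.subspace (poly_space N)"
      by (rule subspace_poly_space)
    then show "real_fun.subspace (respecting (poly_space N) D)"
      by (rule subspace_respecting)
    show "respecting (poly_space N) D \<subseteq> poly_space N"
      by (auto simp: respecting_def)
    show "P ` B \<subseteq> poly_space N"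
      using P by blast
  next
    \<comment> \<open>Independence: a relation among the interpolants modulo the chord conditions is
      carried back to the original basis with the same coefficients.\<close>
    fix c assume "(\<Sum>b\<in>B. fun_scale (c b) (P b)) \<in> respecting (poly_space N) D"
    moreover have "(\<Sum>b\<in>B. fun_scale (c b) b) \<in> C0"
      using B(3) subspace_C0 by (intro real_fun.subspace_sum real_fun.subspace_scale) auto
    ultimately have "(\<Sum>b\<in>B. fun_scale (c b) b) \<in> respecting C0 D"
      by (rule respecting_transfer) (rule sum_diff[symmetric])
    then show "\<forall>b\<in>B. c b = 0"
      by (rule ind)
  next
    \<comment> \<open>Spanning: \<open>v\<close> is continuous, and the coefficients expressing it
      through \<open>B\<close> also work for the interpolants.\<close>
    fix v assume v: "v \<in> poly_space N"
    then obtain c where c: "v - (\<Sum>b\<in>B. fun_scale (c b) b) \<in> respecting C0 D"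
      using span poly_space_subset_C0 by blast
    have "(\<Sum>b\<in>B. fun_scale (c b) (P b)) \<in> poly_space N"
      using P subspace_poly_space by (intro real_fun.subspace_sum real_fun.subspace_scale)
    then have "v - (\<Sum>b\<in>B. fun_scale (c b) (P b)) \<in> poly_space N"
      by (intro real_fun.subspace_diff subspace_poly_space v)
    with c have "v - (\<Sum>b\<in>B. fun_scale (c b) (P b)) \<in> respecting (poly_space N) D"
    proof (rule respecting_transfer)
      fix x y assume "x \<in> \<Union>D" "y \<in> \<Union>D"
      then show "(v - (\<Sum>b\<in>B. fun_scale (c b) (P b))) x - (v - (\<Sum>b\<in>B. fun_scale (c b) (P b))) y =
          (v - (\<Sum>b\<in>B. fun_scale (c b) b)) x - (v - (\<Sum>b\<in>B. fun_scale (c b) b)) y"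
        using sum_diff[of x y c] by simp
    qed
    then show "\<exists>c. v - (\<Sum>b\<in>B. fun_scale (c b) (P b)) \<in> respecting (poly_space N) D"
      by blast
  qed (use B in auto)
qed

end
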